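(* Let $A$ be a Banach algebra, let $B$ be a left Banach $A$-module with action $\pi_\ell:A\times B\to B$, and suppose $A$ has a bounded left approximate identity $(e_\alpha)_\alpha\subseteq A$ such that $e_\alpha\to e''$ weak$^*$ in $A^{**}$, where $e''$ is a left unit for $A^{**}$ (first Arens product). Suppose that $Z^t_{e''}(B^{**})=B^{**}$. Then $B$ factors on the right with respect to $A$ (i.e. $B=AB$) if and only if $e''$ is a left unit for $B^{**}$, i.e. $\pi_\ell^{***}(e'',b'')=b''$ for all $b''\in B^{**}$.
   Context: $AB=\{ab:a\in A,b\in B\}$. For a bounded bilinear map $m:X\times Y\to Z$ of normed spaces, $m^*:Z^*\times X\to Y^*$, $m^{**}:Y^{**}\times Z^*\to X^*$, $m^{***}:X^{**}\times Y^{**}\to Z^{**}$ are defined by $\langle m^*(z',x),y\rangle=\langle z',m(x,y)\rangle$, $\langle m^{**}(y'',z'),x\rangle=\langle y'',m^*(z',x)\rangle$, $\langle m^{***}(x'',y''),z'\rangle=\langle x'',m^{**}(y'',z')\rangle$; $m^t(y,x)=m(x,y)$, and $m^{t***t}(x'',y'')=(m^t)^{***}(y'',x'')$. The first Arens product on $A^{**}$ is $m^{***}$ for $m$ the multiplication of $A$. For $a''\in A^{**}$, $Z^t_{a''}(B^{**})=\{b''\in B^{**}:\pi_\ell^{t***t}(a'',b'')=\pi_\ell^{***}(a'',b'')\}$. *)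

theory Defs
  imports "HOL-Analysis.Analysis"
begin

text \<open>
  The scalar field is a type of class \<open>{real_normed_field, euclidean_space}\<close>. Both
  \<^typ>\<open>real\<close> and \<^typ>\<open>complex\<close> are instances and, by Frobenius' theorem, every instance is
  isomorphic to one of them, so real and complex Banach spaces are treated at once.
  The real scaling built into the type classes of the space is required to be the restriction of
  the scalar multiplication \<open>smul\<close>; completeness comes from the class \<open>banach\<close>.
\<close>

locale normed_space_over = vector_space smul
  for smul :: "'k::{real_normed_field,euclidean_space} \<Rightarrow> 'v::real_normed_vector \<Rightarrow> 'v" +
  assumes norm_scale: "norm (smul c x) = norm c * norm x"
    and scale_of_real: "smul (of_real r) x = r *\<^sub>R x"

locale banach_algebra_over = normed_space_over smul
  for smul :: "'k::{real_normed_field,euclidean_space} \<Rightarrow> 'a::{real_normed_algebra,banach} \<Rightarrow> 'a" +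
  assumes scale_mult_left: "smul c x * y = smul c (x * y)"
    and scale_mult_right: "x * smul c y = smul c (x * y)"

locale left_banach_module_over =
  A: banach_algebra_over scaleA + B: normed_space_over scaleB + action: bounded_bilinear act
  for scaleA :: "'k::{real_normed_field,euclidean_space} \<Rightarrow> 'a::{real_normed_algebra,banach} \<Rightarrow> 'a"
    and scaleB :: "'k \<Rightarrow> 'b::banach \<Rightarrow> 'b"
    and act :: "'a \<Rightarrow> 'b \<Rightarrow> 'b" +
  assumes act_scale_left: "act (scaleA c a) b = scaleB c (act a b)"
    and act_scale_right: "act a (scaleB c b) = scaleB c (act a b)"
    and act_mult: "act (a * a') b = act a (act a' b)"

definition dual :: "('k::{real_normed_field,euclidean_space} \<Rightarrow> 'v::real_normed_vector \<Rightarrow> 'v) \<Rightarrow> ('v \<Rightarrow> 'k) set"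
  where "dual smul = {f. Vector_Spaces.linear smul (*) f \<and> bounded_linear f}"

text \<open>
  Elements of the bidual are functions on \<open>dual smul\<close>, made \<open>undefined\<close> outside it so that
  equality of functions is equality in the bidual; \<^const>\<open>onorm\<close> is the norm of the dual space.
\<close>

definition bidual ::
    "('k::{real_normed_field,euclidean_space} \<Rightarrow> 'v::real_normed_vector \<Rightarrow> 'v) \<Rightarrow> (('v \<Rightarrow> 'k) \<Rightarrow> 'k) set"
  where "bidual smul = {\<phi> \<in> extensional (dual smul).
    (\<forall>f\<in>dual smul. \<forall>g\<in>dual smul. \<phi> (\<lambda>x. f x + g x) = \<phi> f + \<phi> g) \<and>
    (\<forall>c. \<forall>f\<in>dual smul. \<phi> (\<lambda>x. c * f x) = c * \<phi> f) \<and>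
    (\<exists>C. \<forall>f\<in>dual smul. norm (\<phi> f) \<le> C * onorm f)}"

definition to_bidual ::
    "('k::{real_normed_field,euclidean_space} \<Rightarrow> 'v::real_normed_vector \<Rightarrow> 'v) \<Rightarrow> 'v \<Rightarrow> ('v \<Rightarrow> 'k) \<Rightarrow> 'k"
  where "to_bidual smul x = (\<lambda>f\<in>dual smul. f x)"

definition weak_star_tendsto ::
    "('k::{real_normed_field,euclidean_space} \<Rightarrow> 'v::real_normed_vector \<Rightarrow> 'v) \<Rightarrow>
     ('i \<Rightarrow> ('v \<Rightarrow> 'k) \<Rightarrow> 'k) \<Rightarrow> (('v \<Rightarrow> 'k) \<Rightarrow> 'k) \<Rightarrow> 'i filter \<Rightarrow> bool"
  where "weak_star_tendsto smul \<Phi> \<phi> F \<longleftrightarrow> (\<forall>f\<in>dual smul. ((\<lambda>i. \<Phi> i f) \<longlongrightarrow> \<phi> f) F)"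

text \<open>
  \<open>adj m\<close> is \<open>m\<^sup>*\<close>; the same formula applied to \<open>m\<^sup>*\<close> and \<open>m\<^sup>*\<^sup>*\<close> gives \<open>m\<^sup>*\<^sup>*\<close> and \<open>m\<^sup>*\<^sup>*\<^sup>*\<close>.
  Applied to functionals from the respective (bi)duals, \<open>m\<^sup>*\<close> and \<open>m\<^sup>*\<^sup>*\<close> again take values in
  duals; only \<open>m\<^sup>*\<^sup>*\<^sup>*\<close> has to be restricted to the dual of the target space, whose scalar
  multiplication is the first argument of \<open>triple_adj\<close>.
\<close>

definition adj :: "('x \<Rightarrow> 'y \<Rightarrow> 'z) \<Rightarrow> ('z \<Rightarrow> 'k) \<Rightarrow> 'x \<Rightarrow> 'y \<Rightarrow> 'k"
  where "adj m z' x = (\<lambda>y. z' (m x y))"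

definition triple_adj ::
    "('k::{real_normed_field,euclidean_space} \<Rightarrow> 'z::real_normed_vector \<Rightarrow> 'z) \<Rightarrow> ('x \<Rightarrow> 'y \<Rightarrow> 'z) \<Rightarrow>
     (('x \<Rightarrow> 'k) \<Rightarrow> 'k) \<Rightarrow> (('y \<Rightarrow> 'k) \<Rightarrow> 'k) \<Rightarrow> ('z \<Rightarrow> 'k) \<Rightarrow> 'k"
  where "triple_adj scaleZ m x'' y'' = restrict (adj (adj (adj m)) x'' y'') (dual scaleZ)"

definition bil_transp :: "('x \<Rightarrow> 'y \<Rightarrow> 'z) \<Rightarrow> 'y \<Rightarrow> 'x \<Rightarrow> 'z"
  where "bil_transp m y x = m x y"

definition transp_triple_adj_transp ::
    "('k::{real_normed_field,euclidean_space} \<Rightarrow> 'z::real_normed_vector \<Rightarrow> 'z) \<Rightarrow> ('x \<Rightarrow> 'y \<Rightarrow> 'z) \<Rightarrow>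
     (('x \<Rightarrow> 'k) \<Rightarrow> 'k) \<Rightarrow> (('y \<Rightarrow> 'k) \<Rightarrow> 'k) \<Rightarrow> ('z \<Rightarrow> 'k) \<Rightarrow> 'k"
  where "transp_triple_adj_transp scaleZ m = bil_transp (triple_adj scaleZ (bil_transp m))"

definition first_arens ::
    "('k::{real_normed_field,euclidean_space} \<Rightarrow> 'a::{real_normed_algebra,banach} \<Rightarrow> 'a) \<Rightarrow>
     (('a \<Rightarrow> 'k) \<Rightarrow> 'k) \<Rightarrow> (('a \<Rightarrow> 'k) \<Rightarrow> 'k) \<Rightarrow> ('a \<Rightarrow> 'k) \<Rightarrow> 'k"
  where "first_arens scaleA = triple_adj scaleA (*)"

definition Zt ::
    "('k::{real_normed_field,euclidean_space} \<Rightarrow> 'b::real_normed_vector \<Rightarrow> 'b) \<Rightarrow> ('a \<Rightarrow> 'b \<Rightarrow> 'b) \<Rightarrow>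
     (('a \<Rightarrow> 'k) \<Rightarrow> 'k) \<Rightarrow> (('b \<Rightarrow> 'k) \<Rightarrow> 'k) set"
  where "Zt scaleB act a'' =
    {b'' \<in> bidual scaleB. transp_triple_adj_transp scaleB act a'' b'' = triple_adj scaleB act a'' b''}"

text \<open>Nets are rendered as families along a nontrivial filter on the index type.\<close>

definition bounded_left_approx_identity :: "('i \<Rightarrow> 'a::real_normed_algebra) \<Rightarrow> 'i filter \<Rightarrow> bool"
  where "bounded_left_approx_identity e F \<longleftrightarrow>
    F \<noteq> bot \<and> bounded (range e) \<and> (\<forall>a. ((\<lambda>i. e i * a) \<longlongrightarrow> a) F)"

definition factors_on_right :: "('a \<Rightarrow> 'b \<Rightarrow> 'b) \<Rightarrow> bool"
  where "factors_on_right act \<longleftrightarrow> UNIV = {act a b | a b. True}"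

end

theory Submission
  imports Defs
begin

text \<open>
  Write \<open>f\<cdot>b\<close> for the functional \<open>a \<mapsto> f (a b)\<close> on the algebra. Since \<open>e''\<close> is the weak* limit of the
  net, \<open>e'' (f\<cdot>b) = lim f (e\<^sub>i b)\<close> for every \<open>f\<close> in the dual of the module and every \<open>b\<close>
  (\<open>weak_star_limit_on_orbit\<close>), and both implications read off what this limit is.

  If every \<open>b\<close> is a product \<open>a y\<close>, then \<open>e\<^sub>i b = (e\<^sub>i a) y \<rightarrow> b\<close>, so \<open>e'' (f\<cdot>b) = f b\<close>. The transposed
  extension of the action applies \<open>b''\<close> to \<open>b \<mapsto> e'' (f\<cdot>b)\<close>, which is now \<open>f\<close> itself; hence \<open>e''\<close> is a
  left unit for the transposed extension (\<open>unit_if_approx_identity_converges\<close>). The hypothesis on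
  \<open>Zt\<close> says that the two extensions agree at \<open>e''\<close>.

  Conversely, if \<open>e''\<close> is a left unit, testing it on the canonical image of \<open>b\<close> shows that
  \<open>e\<^sub>i b \<rightarrow> b\<close> weakly. The set of all \<open>x\<close> with \<open>e\<^sub>i x \<rightarrow> x\<close> in norm is a closed subspace, because the
  net is bounded, and contains every product \<open>a x\<close>. A functional vanishing on it vanishes at all
  \<open>e\<^sub>i b\<close>, hence at \<open>b\<close>; by the Hahn--Banach theorem \<open>b\<close> lies in it
  (\<open>approx_identity_converges_if_weakly\<close>). Cohen's factorization theorem then writes \<open>b\<close> as a product.

  The analytic ingredients proved along the way are thus a Hahn--Banach separation theorem over the
  abstract scalar field and Cohen's theorem for modules.
\<close>

section \<open>The Hahn--Banach theorem\<close>

lemma between_sets: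
  fixes L R :: "real set"
  assumes "L \<noteq> {}" "R \<noteq> {}" and le: "\<And>l r. l \<in> L \<Longrightarrow> r \<in> R \<Longrightarrow> l \<le> r"
  obtains c where "\<And>l. l \<in> L \<Longrightarrow> l \<le> c" "\<And>r. r \<in> R \<Longrightarrow> c \<le> r"
proof
  have "bdd_above L"
    using assms by (meson bdd_aboveI ex_in_conv)
  then show "l \<le> Sup L" if "l \<in> L" for l
    using that by (rule cSup_upper[rotated])
  show "Sup L \<le> r" if "r \<in> R" for r
    using \<open>L \<noteq> {}\<close> le that by (intro cSup_least) auto
qed

text \<open>
  Partially defined linear functionals below \<open>p\<close> are represented by their graphs. Single-valuedness
  need not be demanded, since a sublinear bound forces it (\<open>dominated_graph_unique\<close>); this makes
  unions of chains and one-dimensional extensions questions about subspaces only.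
\<close>

definition dominated_graph :: "('v::real_vector \<Rightarrow> real) \<Rightarrow> ('v \<times> real) set \<Rightarrow> bool"
  where "dominated_graph p G \<longleftrightarrow> subspace G \<and> (\<forall>(x, r)\<in>G. r \<le> p x)"

locale sublinear =
  fixes p :: "'v::real_vector \<Rightarrow> real"
  assumes add_le: "p (x + y) \<le> p x + p y"
    and scale_nonneg: "r \<ge> 0 \<Longrightarrow> p (r *\<^sub>R x) = r * p x"
begin

lemma zero: "p 0 = 0"
  using scale_nonneg[of 0 0] by simp

lemma dominated_graph_unique:
  assumes G: "dominated_graph p G" and "(x, r) \<in> G" "(x, s) \<in> G"
  shows "r = s"
proof -
  have sub: "subspace G" and le: "\<And>x r. (x, r) \<in> G \<Longrightarrow> r \<le> p x"
    using G by (auto simp: dominated_graph_def)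
  have "(0, r - s) \<in> G" "(0, s - r) \<in> G"
    using subspace_diff[OF sub] assms(2,3) by (metis diff_Pair diff_self)+
  then show ?thesis
    using le[of 0 "r - s"] le[of 0 "s - r"] zero by simp
qed

text \<open>
  The admissible values \<open>r\<close> at the new point \<open>x\<close> are those with \<open>s - p (y - x) \<le> r \<le> p (y + x) - s\<close>
  for all \<open>(y, s)\<close> in the graph. Subadditivity says that every such lower bound is below every such
  upper bound.
\<close>

lemma dominated_graph_extend:
  assumes G: "dominated_graph p G"
  obtains r where "dominated_graph p (span (insert (x, r) G))"
proof -
  have sub: "subspace G" and le: "\<And>x r. (x, r) \<in> G \<Longrightarrow> r \<le> p x"
    using G by (auto simp: dominated_graph_def)
  have zero_mem: "(0, 0) \<in> G"
    using subspace_0[OF sub] by (simp add: zero_prod_def)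
  obtain r where lower: "\<And>l. l \<in> (\<lambda>(y, s). s - p (y - x)) ` G \<Longrightarrow> l \<le> r"
    and upper: "\<And>u. u \<in> (\<lambda>(y, s). p (y + x) - s) ` G \<Longrightarrow> r \<le> u"
  proof (rule between_sets)
    fix l u assume "l \<in> (\<lambda>(y, s). s - p (y - x)) ` G" "u \<in> (\<lambda>(y, s). p (y + x) - s) ` G"
    then obtain y s y' s' where *: "(y, s) \<in> G" "(y', s') \<in> G" "l = s - p (y - x)" "u = p (y' + x) - s'"
      by auto
    have "(y + y', s + s') \<in> G"
      using subspace_add[OF sub *(1,2)] by simp
    then have "s + s' \<le> p (y + y')"
      by (rule le)
    also have "\<dots> \<le> p (y - x) + p (y' + x)"
      using add_le[of "y - x" "y' + x"] by simp
    finally show "l \<le> u"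
      using * by simp
  qed (use zero_mem in auto)
  have bound: "s + t * r \<le> p (y + t *\<^sub>R x)" if ys: "(y, s) \<in> G" for y s t
  proof (cases t "0::real" rule: linorder_cases)
    case equal
    then show ?thesis using le[OF ys] by simp
  next
    case greater
    have "((1/t) *\<^sub>R y, s / t) \<in> G"
      using subspace_scale[OF sub ys, of "1/t"] by simp
    then have "r \<le> p ((1/t) *\<^sub>R y + x) - s / t"
      by (intro upper) force
    then have "t * r \<le> t * (p ((1/t) *\<^sub>R y + x) - s / t)"
      using greater by simp
    also have "\<dots> = p (t *\<^sub>R ((1/t) *\<^sub>R y + x)) - s"
      using greater scale_nonneg[of t "(1/t) *\<^sub>R y + x"] by (simp add: algebra_simps)
    finally show ?thesis
      using greater by (simp add: scaleR_add_right)
  next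
    case less
    define t' where "t' = - t"
    have t': "t' > 0" "t = - t'"
      using less by (auto simp: t'_def)
    have "((1/t') *\<^sub>R y, s / t') \<in> G"
      using subspace_scale[OF sub ys, of "1/t'"] by simp
    then have "s / t' - p ((1/t') *\<^sub>R y - x) \<le> r"
      by (intro lower) force
    then have "t' * (s / t' - p ((1/t') *\<^sub>R y - x)) \<le> t' * r"
      using t' by simp
    moreover have "t' * (s / t' - p ((1/t') *\<^sub>R y - x)) = s - p (t' *\<^sub>R ((1/t') *\<^sub>R y - x))"
      using t' scale_nonneg[of t' "(1/t') *\<^sub>R y - x"] by (simp add: algebra_simps)
    ultimately show ?thesis
      using t' by (simp add: scaleR_diff_right)
  qed
  have "dominated_graph p (span (insert (x, r) G))"
    unfolding dominated_graph_def
  proof (intro conjI ballI)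
    fix z assume "z \<in> span (insert (x, r) G)"
    then obtain t where "z - t *\<^sub>R (x, r) \<in> span G"
      by (auto simp: span_breakdown_eq)
    then have "z - t *\<^sub>R (x, r) \<in> G"
      using sub by (metis span_eq_iff)
    moreover obtain y s where ys: "z - t *\<^sub>R (x, r) = (y, s)"
      by fastforce
    ultimately have "s + t * r \<le> p (y + t *\<^sub>R x)"
      by (intro bound) simp
    moreover have "z = (y + t *\<^sub>R x, s + t * r)"
      using ys by (cases z) auto
    ultimately show "case z of (x, r) \<Rightarrow> r \<le> p x"
      by simp
  qed simp
  then show ?thesis ..
qed

text \<open>
  On the line through \<open>x0\<close> the functional \<open>t *\<^sub>R x0 \<mapsto> t * p x0\<close> is below \<open>p\<close>. A maximal graph
  containing it is total, because any graph can be extended to any further point.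
\<close>

theorem hahn_banach:
  obtains g where "linear g" "\<And>x. g x \<le> p x" "g x0 = p x0"
proof -
  define \<G> where "\<G> = {G. dominated_graph p G \<and> (x0, p x0) \<in> G}"
  have "t * p x0 \<le> p (t *\<^sub>R x0)" for t
  proof (cases "t \<ge> 0")
    case True
    then show ?thesis by (simp add: scale_nonneg)
  next
    case False
    then show ?thesis
      using add_le[of "t *\<^sub>R x0" "(- t) *\<^sub>R x0"] scale_nonneg[of "- t" x0] zero by simp
  qed
  then have "dominated_graph p (span {(x0, p x0)})"
    unfolding dominated_graph_def
    by (intro conjI subspace_span) (auto simp: span_singleton)
  then have "span {(x0, p x0)} \<in> \<G>"
    by (simp add: \<G>_def span_base)
  then have "\<G> \<noteq> {}"
    by blast
  moreover have "\<Union>\<C> \<in> \<G>" if "\<C> \<noteq> {}" and chain: "subset.chain \<G> \<C>" for \<C>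
  proof -
    have mem: "\<And>G. G \<in> \<C> \<Longrightarrow> subspace G \<and> (\<forall>(x, r)\<in>G. r \<le> p x) \<and> (x0, p x0) \<in> G"
      using chain by (auto simp: subset.chain_def \<G>_def dominated_graph_def)
    have "subspace (\<Union>\<C>)"
      unfolding subspace_def
    proof (intro conjI ballI allI)
      show "0 \<in> \<Union>\<C>"
        using \<open>\<C> \<noteq> {}\<close> mem subspace_0 by blast
      show "x + y \<in> \<Union>\<C>" if xy: "x \<in> \<Union>\<C>" "y \<in> \<Union>\<C>" for x y
      proof -
        obtain G H where "G \<in> \<C>" "H \<in> \<C>" "x \<in> G" "y \<in> H"
          using xy by blast
        moreover from this have "G \<subseteq> H \<or> H \<subseteq> G"
          using chain by (auto simp: subset.chain_def)
        ultimately show ?thesis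
          using mem subspace_add by blast
      qed
      show "c *\<^sub>R x \<in> \<Union>\<C>" if "x \<in> \<Union>\<C>" for c x
        using that mem subspace_scale by blast
    qed
    then show ?thesis
      using mem \<open>\<C> \<noteq> {}\<close> by (fastforce simp: \<G>_def dominated_graph_def)
  qed
  ultimately obtain G where G: "G \<in> \<G>" and maximal: "\<And>H. H \<in> \<G> \<Longrightarrow> G \<subseteq> H \<Longrightarrow> H = G"
    using subset_Zorn_nonempty[of \<G>] by metis
  have dom: "dominated_graph p G" and x0: "(x0, p x0) \<in> G"
    using G by (auto simp: \<G>_def)
  have sub: "subspace G" and le: "\<And>x r. (x, r) \<in> G \<Longrightarrow> r \<le> p x"
    using dom by (auto simp: dominated_graph_def)
  have "\<exists>r. (x, r) \<in> G" for x
  proof -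
    obtain r where r: "dominated_graph p (span (insert (x, r) G))"
      using dominated_graph_extend[OF dom] .
    have "insert (x, r) G \<subseteq> span (insert (x, r) G)"
      by (rule span_superset)
    then show ?thesis
      using maximal[of "span (insert (x, r) G)"] r x0 by (auto simp: \<G>_def)
  qed
  then obtain g where g: "\<And>x. (x, g x) \<in> G"
    by metis
  have unique: "g x = r" if "(x, r) \<in> G" for x r
    using dominated_graph_unique[OF dom g that] .
  have "linear g"
  proof (rule linearI)
    show "g (x + y) = g x + g y" for x y
      using subspace_add[OF sub g[of x] g[of y]] by (intro unique) simp
    show "g (c *\<^sub>R x) = c *\<^sub>R g x" for c x
      using subspace_scale[OF sub g[of x], of c] by (intro unique) simp
  qed
  then show thesis
    using that g le unique[OF x0] by blast
qed

end

lemma sublinear_infdist: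
  fixes S :: "'v::real_normed_vector set"
  assumes S: "subspace S"
  shows "sublinear (\<lambda>x. infdist x S)"
proof
  have ne: "S \<noteq> {}"
    using subspace_0[OF S] by blast
  have near: "\<exists>s\<in>S. norm (x - s) < infdist x S + \<epsilon>" if "\<epsilon> > 0" for x and \<epsilon> :: real
  proof -
    have "(INF s\<in>S. dist x s) < infdist x S + \<epsilon>"
      using that ne by (simp add: infdist_def)
    then show ?thesis
      using ne by (subst (asm) cINF_less_iff) (auto simp: dist_norm intro: bdd_belowI2[of _ 0])
  qed
  show "infdist (x + y) S \<le> infdist x S + infdist y S" for x y
  proof (rule field_le_epsilon)
    fix \<epsilon> :: real assume "\<epsilon> > 0"
    then obtain s t where st: "s \<in> S" "t \<in> S" "norm (x - s) < infdist x S + \<epsilon>/2" "norm (y - t) < infdist y S + \<epsilon>/2"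
      using near[of "\<epsilon>/2"] by (metis half_gt_zero)
    have "infdist (x + y) S \<le> norm ((x + y) - (s + t))"
      using infdist_le[of "s + t" S] subspace_add[OF S st(1,2)] by (simp add: dist_norm)
    also have "\<dots> \<le> norm (x - s) + norm (y - t)"
      by (rule norm_diff_triangle_ineq)
    finally show "infdist (x + y) S \<le> infdist x S + infdist y S + \<epsilon>"
      using st by simp
  qed
  have scale_le: "infdist (r *\<^sub>R x) S \<le> r * infdist x S" if "r > 0" for r x
  proof (rule field_le_epsilon)
    fix \<epsilon> :: real assume "\<epsilon> > 0"
    then obtain s where s: "s \<in> S" "norm (x - s) < infdist x S + \<epsilon> / r"
      using near[of "\<epsilon> / r" x] divide_pos_pos[of \<epsilon> r] \<open>r > 0\<close> by blast
    have "infdist (r *\<^sub>R x) S \<le> norm (r *\<^sub>R x - r *\<^sub>R s)"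
      using infdist_le[of "r *\<^sub>R s" S] subspace_scale[OF S s(1)] by (simp add: dist_norm)
    also have "\<dots> = r * norm (x - s)"
      using that by (simp flip: scaleR_diff_right)
    also have "\<dots> \<le> r * (infdist x S + \<epsilon> / r)"
      using s that by (intro mult_left_mono) auto
    finally show "infdist (r *\<^sub>R x) S \<le> r * infdist x S + \<epsilon>"
      using that by (simp add: algebra_simps)
  qed
  show "infdist (r *\<^sub>R x) S = r * infdist x S" if "r \<ge> 0" for r x
  proof (cases "r = 0")
    case True
    then show ?thesis
      using subspace_0[OF S] by simp
  next
    case False
    then have r: "r > 0" using that by simp
    have "infdist x S \<le> (1/r) * infdist (r *\<^sub>R x) S"
      using scale_le[of "1/r" "r *\<^sub>R x"] r by simp
    then show ?thesis
      using scale_le[OF r, of x] r by (simp add: field_simps)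
  qed
qed

text \<open>
  A linear functional below the distance to \<open>S\<close> automatically vanishes on \<open>S\<close> and has norm at most 1,
  and the Hahn--Banach theorem provides one that attains the distance at \<open>x0\<close>.
\<close>

lemma separate_point_closed_subspace:
  fixes S :: "'v::real_normed_vector set"
  assumes S: "subspace S" "closed S" and x0: "x0 \<notin> S"
  obtains g :: "'v \<Rightarrow> real" where "bounded_linear g" "\<And>x. x \<in> S \<Longrightarrow> g x = 0" "g x0 \<noteq> 0"
proof -
  interpret sublinear "\<lambda>x. infdist x S"
    by (rule sublinear_infdist[OF S(1)])
  obtain g where g: "linear g" "\<And>x. g x \<le> infdist x S" "g x0 = infdist x0 S"
    using hahn_banach[of x0] by blast
  have le: "\<bar>g x\<bar> \<le> infdist x S" for x
  proof -
    have "infdist (- x) S \<le> infdist x S" 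
      if "S \<noteq> {}" for x
    proof -
      have "infdist (- x) S \<le> dist x s" if "s \<in> S" for s
        using infdist_le[of "- s" S "- x"] subspace_neg[OF S(1) that] by (simp add: dist_minus)
      then show ?thesis
        using that unfolding infdist_notempty[OF that, of x] by (intro cINF_greatest) auto
    qed
    then show ?thesis
      using g(2)[of x] g(2)[of "- x"] linear_neg[OF g(1)] subspace_0[OF S(1)] by (smt (verit) empty_iff)
  qed
  have "infdist x S \<le> norm x" for x
    using infdist_le[OF subspace_0[OF S(1)], of x] by simp
  then have "bounded_linear g"
    using g(1) le by (intro bounded_linear_intro[where K = 1])
      (auto simp: linear_add linear_scale intro: order_trans)
  moreover have "g x = 0" if "x \<in> S" for x
    using le[of x] that by simp
  moreover have "g x0 \<noteq> 0"
    using g(3) S x0 in_closed_iff_infdist_zero[OF S(2)] subspace_0[OF S(1)] by auto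
  ultimately show thesis ..
qed

lemma (in normed_space_over) dual_iff:
  "f \<in> dual smul \<longleftrightarrow> (\<forall>x y. f (x + y) = f x + f y) \<and> (\<forall>c x. f (smul c x) = c * f x) \<and> (\<exists>K. \<forall>x. norm (f x) \<le> norm x * K)"
proof -
  have "f (r *\<^sub>R x) = r *\<^sub>R f x" if "\<forall>c x. f (smul c x) = c * f x" for r x
    using that by (metis scaleR_conv_of_real scale_of_real)
  then show ?thesis
    unfolding dual_def mem_Collect_eq Vector_Spaces.linear_iff bounded_linear_def bounded_linear_axioms_def
      Real_Vector_Spaces.linear_iff
    using vector_space_axioms vector_space_over_itself.vector_space_axioms by blast
qed

text \<open>
  For complex scalars this is the correspondence \<open>g = Re f\<close>. In general \<open>inner 1\<close> plays the role of
  the real part: every real functional on the finite-dimensional scalar field has the form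
  \<open>c \<mapsto> 1 \<bullet> (c * d)\<close> for exactly one \<open>d\<close>, and \<open>f x\<close> is the \<open>d\<close> belonging to \<open>c \<mapsto> g (c x)\<close>.
  Uniqueness of \<open>d\<close> holds because a nonzero \<open>d\<close> can be inverted and \<open>1 \<bullet> 1 \<noteq> 0\<close>; existence follows by
  comparing dimensions; uniqueness also makes \<open>f\<close> linear over the scalar field.
\<close>

lemma (in normed_space_over) real_functional_is_component:
  fixes g :: "'v \<Rightarrow> real"
  assumes g: "bounded_linear g"
  obtains f where "f \<in> dual smul" "\<And>x. g x = 1 \<bullet> f x"
proof -
  interpret g: bounded_linear g by fact
  \<comment> \<open>\<open>J d\<close> is the Riesz representative of \<open>c \<mapsto> 1 \<bullet> (c * d)\<close>, and \<open>v x\<close> below that of \<open>c \<mapsto> g (c x)\<close>.\<close>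
  define J :: "'k \<Rightarrow> 'k" where "J d = adjoint (\<lambda>c. c * d) 1" for d
  have J: "c \<bullet> J d = 1 \<bullet> (c * d)" for c d
    using adjoint_works[OF bounded_linear.linear[OF bounded_linear_mult_left[of d]], of c 1]
    by (simp add: J_def inner_commute)
  have linJ: "linear J"
    by (rule linearI; rule vector_eq_rdot[THEN iffD1]) (simp_all add: J algebra_simps inner_add_right inner_commute)
  have cancel: "d = d'" if "\<And>c. 1 \<bullet> (c * d) = 1 \<bullet> (c * d')" for d d' :: 'k
  proof (rule ccontr)
    assume "d \<noteq> d'"
    then have "1 \<bullet> (1 :: 'k) = 1 \<bullet> (inverse (d - d') * (d - d'))"
      by simp
    also have "\<dots> = 0"
      using that[of "inverse (d - d')"] by (simp add: right_diff_distrib inner_diff_right)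
    finally show False by simp
  qed
  have injJ: "inj J"
    by (rule injI, rule cancel) (metis J)
  have lin: "linear (\<lambda>c. g (smul c x))" for x
  proof (rule linearI)
    show "g (smul (c + d) x) = g (smul c x) + g (smul d x)" for c d
      by (simp add: scale_left_distrib g.add)
    show "g (smul (r *\<^sub>R c) x) = r *\<^sub>R g (smul c x)" for r c
      by (metis g.scaleR scaleR_conv_of_real scale_of_real scale_scale)
  qed
  define v where "v x = adjoint (\<lambda>c. g (smul c x)) 1" for x
  have v: "c \<bullet> v x = g (smul c x)" for c x
    using adjoint_works[OF lin, of c x 1] by (simp add: v_def)
  have "\<exists>d. J d = v x" for x
    using linear_injective_imp_surjective[OF linJ injJ] by (metis surjD)
  then obtain f where Jf: "\<And>x. J (f x) = v x"
    by metis
  have f: "1 \<bullet> (c * f x) = g (smul c x)" for c x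
    using J[of c "f x"] by (simp add: Jf v)
  have "f (x + y) = f x + f y" for x y
    by (rule cancel) (simp add: distrib_left inner_add_right f scale_right_distrib g.add)
  moreover have "f (smul c x) = c * f x" for c x
  proof (rule cancel)
    show "1 \<bullet> (d * f (smul c x)) = 1 \<bullet> (d * (c * f x))" for d
      using f[of "d * c" x] by (simp add: f mult.assoc)
  qed
  moreover have "\<exists>K. \<forall>x. norm (f x) \<le> norm x * K"
  proof -
    obtain B where B: "B > 0" "\<And>d. B * norm d \<le> norm (J d)"
      using linear_inj_bounded_below_pos[OF linJ injJ] by blast
    obtain K where K: "\<And>x. norm (g x) \<le> norm x * K"
      using g.bounded by blast
    have "norm (f x) \<le> norm x * (K / B)" for x
    proof -
      have "norm (v x) * norm (v x) = g (smul (v x) x)"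
        by (metis v power2_eq_square power2_norm_eq_inner)
      also have "\<dots> \<le> norm (v x) * (norm x * K)"
        using K[of "smul (v x) x"] by (simp add: norm_scale mult.assoc)
      finally have "norm (v x) \<le> norm x * K"
        using K[of x] by (cases "v x = 0") (auto simp: mult_le_cancel_left intro: order_trans[OF norm_ge_zero])
      then have "B * norm (f x) \<le> norm x * K"
        using B(2)[of "f x"] by (simp add: Jf)
      then show ?thesis
        using B(1) by (simp add: field_simps)
    qed
    then show ?thesis by blast
  qed
  ultimately have "f \<in> dual smul"
    by (simp add: dual_iff)
  moreover have "g x = 1 \<bullet> f x" for x
    using f[of 1 x] by simp
  ultimately show thesis ..
qed

lemma (in normed_space_over) dual_separates_closed_subspace:
  assumes S: "module.subspace smul S" "closed S" and x0: "x0 \<notin> S"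
  obtains f where "f \<in> dual smul" "\<And>x. x \<in> S \<Longrightarrow> f x = 0" "f x0 \<noteq> 0"
proof -
  have smul_mem: "smul c x \<in> S" if "x \<in> S" for c x
    using S(1) that by (simp add: subspace_def)
  have "Real_Vector_Spaces.subspace S"
    using S(1) smul_mem scale_of_real by (metis Real_Vector_Spaces.subspace_def subspace_def)
  then obtain g :: "'v \<Rightarrow> real" where g: "bounded_linear g" "\<And>x. x \<in> S \<Longrightarrow> g x = 0" "g x0 \<noteq> 0"
    using separate_point_closed_subspace S(2) x0 by metis
  obtain f where f: "f \<in> dual smul" "\<And>x. g x = 1 \<bullet> f x"
    using real_functional_is_component[OF g(1)] by blast
  have "f x = 0" if x: "x \<in> S" for x
  proof (rule ccontr)
    assume "f x \<noteq> 0"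
    then have "f (smul (inverse (f x)) x) = 1"
      using f(1) by (simp add: dual_iff)
    then show False
      using g(2)[OF smul_mem[OF x, of "inverse (f x)"]] f(2) by simp
  qed
  moreover have "f x0 \<noteq> 0"
    using g(3) f(2) by auto
  ultimately show thesis
    using f(1) that by blast
qed


section \<open>Cohen's factorization theorem\<close>

text \<open>The inverse of \<open>1 + T\<close>: its value at \<open>y\<close> is the fixed point of the contraction \<open>z \<mapsto> y - T z\<close>.\<close>

lemma neumann_inverse:
  fixes T :: "'b::banach \<Rightarrow> 'b"
  assumes T: "bounded_linear T" and half: "\<And>x. norm (T x) \<le> norm x / 2"
  obtains V where "bounded_linear V" "\<And>x. V x + T (V x) = x" "\<And>x. V (x + T x) = x"
    "\<And>x. norm (V x) \<le> 2 * norm x"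
proof -
  interpret T: bounded_linear T by fact
  have ex1: "\<exists>!z. y - T z = z" for y
  proof (rule banach_fix_type)
    have "dist (y - T u) (y - T v) \<le> 1/2 * dist u v" for u v
    proof -
      have "dist (y - T u) (y - T v) = norm (T (v - u))"
        by (simp add: dist_norm T.diff)
      then show ?thesis
        using half[of "v - u"] by (simp add: dist_norm norm_minus_commute)
    qed
    then show "\<forall>u v. dist (y - T u) (y - T v) \<le> 1/2 * dist u v"
      by blast
  qed auto
  define V where "V y = (THE z. y - T z = z)" for y
  have V: "y - T (V y) = V y" for y
    unfolding V_def by (rule theI'[OF ex1])
  have unique: "z = V y" if "y - T z = z" for y z
    using ex1[of y] V[of y] that by blast
  have "V (x + y) = V x + V y" for x y
  proof (rule unique[symmetric])
    have "x + y - T (V x + V y) = (x - T (V x)) + (y - T (V y))"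
      by (simp add: T.add)
    then show "x + y - T (V x + V y) = V x + V y"
      by (simp only: V)
  qed
  moreover have "V (r *\<^sub>R x) = r *\<^sub>R V x" for r x
  proof (rule unique[symmetric])
    have "r *\<^sub>R x - T (r *\<^sub>R V x) = r *\<^sub>R (x - T (V x))"
      by (simp add: T.scaleR scaleR_diff_right)
    then show "r *\<^sub>R x - T (r *\<^sub>R V x) = r *\<^sub>R V x"
      by (simp only: V)
  qed
  moreover have le: "norm (V x) \<le> 2 * norm x" for x
  proof -
    have "norm (V x) \<le> norm x + norm (T (V x))"
      using V[of x] norm_triangle_ineq4[of x "T (V x)"] by simp
    then show ?thesis
      using half[of "V x"] by simp
  qed
  ultimately have "bounded_linear V"
    by (intro bounded_linear_intro[where K = 2]) (simp_all add: mult.commute)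
  moreover have "V x + T (V x) = x" for x
    using V[of x] by (simp only: diff_eq_eq)
  moreover have "V (x + T x) = x" for x
    by (rule unique[symmetric]) simp
  ultimately show thesis
    using le that by blast
qed

lemma convergent_if_increments_le:
  fixes X :: "nat \<Rightarrow> 'v::banach"
  assumes "\<And>n. norm (X (Suc n) - X n) \<le> u n" and "summable u"
  shows "convergent X"
proof -
  have "summable (\<lambda>n. X (Suc n) - X n)"
    using assms by (rule summable_comparison_test'[rotated])
  then have "convergent (\<lambda>n. X n - X 0)"
    by (simp only: summable_iff_convergent sum_lessThan_telescope)
  then have "convergent (\<lambda>n. (X n - X 0) + X 0)"
    by (rule convergent_add[OF _ convergent_const])
  then show ?thesis by simp
qed

text \<open>
  In the unitization of the algebra consider \<open>u\<^sub>n = t (1 + d e\<^sub>n)\<close>, where \<open>t + t d = 1\<close>, \<open>d\<close> is so small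
  that \<open>u\<^sub>n\<close> acts invertibly on the module, and \<open>e\<^sub>n\<close> is a member of the approximate identity still
  to be chosen. Write the product \<open>u\<^sub>n \<cdots> u\<^sub>1\<close> as \<open>a\<^sub>n + t\<^sup>n\<close> with \<open>a\<^sub>n\<close> in the algebra, and let \<open>V\<^sub>n\<close> be the
  inverse of its action, so that \<open>a\<^sub>n (V\<^sub>n b) + t\<^sup>n V\<^sub>n b = b\<close>. If \<open>a\<^sub>n\<close> and \<open>V\<^sub>n b\<close> converge, the limit of this
  equation is the desired factorization, as \<open>t < 1\<close>. Now with \<open>e = e\<^bsub>n+1\<^esub>\<close>,
  \<open>a\<^bsub>n+1\<^esub> - a\<^sub>n = (1 - t) (e a\<^sub>n - a\<^sub>n) + (1 - t) t\<^sup>n e\<close> and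
  \<open>V\<^bsub>n+1\<^esub> b - V\<^sub>n b = V\<^sub>n (u\<^bsub>n+1\<^esub>\<^sup>-\<^sup>1 b - b)\<close>. Since \<open>e\<close> is chosen after \<open>a\<^sub>n\<close> and \<open>V\<^sub>n\<close>, it can make
  \<open>e a\<^sub>n - a\<^sub>n\<close> and \<open>e b - b\<close>, and hence both increments, as small as needed for summability,
  however large the norm of \<open>V\<^sub>n\<close> may be.
\<close>

theorem cohen_factorization:
  fixes act :: "'a::{real_normed_algebra,banach} \<Rightarrow> 'b::banach \<Rightarrow> 'b"
  assumes act: "bounded_bilinear act"
    and act_mult: "\<And>a a' b. act (a * a') b = act a (act a' b)"
    and e: "bounded_left_approx_identity e F"
    and b: "((\<lambda>i. act (e i) b) \<longlongrightarrow> b) F"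
  obtains a y where "b = act a y"
proof -
  interpret act: bounded_bilinear act by fact
  have "F \<noteq> bot" and e_mult: "\<And>a. ((\<lambda>i. e i * a) \<longlongrightarrow> a) F"
    using e by (auto simp: bounded_left_approx_identity_def)
  obtain C where C: "C > 0" "\<And>i. norm (e i) \<le> C"
    using e by (auto simp: bounded_left_approx_identity_def bounded_pos)
  obtain K where K: "K > 0" "\<And>a b. norm (act a b) \<le> norm a * norm b * K"
    using act.pos_bounded by blast
  define d where "d = 1 / (2 * C * K)"
  define t where "t = 1 / (1 + d)"
  have d: "d > 0"
    using C K by (simp add: d_def)
  have t: "0 < t" "t < 1" "t * d = 1 - t"
    using d by (simp_all add: t_def field_simps)
  have half: "norm (d *\<^sub>R act (e i) x) \<le> norm x / 2" for i x
  proof -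
    have "norm (act (e i) x) \<le> C * norm x * K"
      using K(2)[of "e i" x] C(2)[of i] K(1)
      by (smt (verit) mult_right_mono norm_ge_zero)
    then have "d * norm (act (e i) x) \<le> d * (C * norm x * K)"
      using d by simp
    also have "\<dots> = norm x / 2"
      using C K by (simp add: d_def)
    finally show ?thesis
      using d by simp
  qed
  \<comment> \<open>The states are pairs \<open>(a\<^sub>n, V\<^sub>n)\<close>.\<close>
  define P where "P n s \<longleftrightarrow> bounded_linear (snd s) \<and> (\<forall>x. act (fst s) (snd s x) + t ^ n *\<^sub>R snd s x = x)"
    for n and s :: "'a \<times> ('b \<Rightarrow> 'b)"
  define Q where "Q n s s' \<longleftrightarrow> norm (fst s' - fst s) \<le> (1/2) ^ n + t ^ n * C \<and> norm (snd s' b - snd s b) \<le> (1/2) ^ n"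
    for n :: nat and s s' :: "'a \<times> ('b \<Rightarrow> 'b)"
  have "\<exists>s. \<forall>n. P n (s n) \<and> Q n (s n) (s (Suc n))"
  proof (rule dependent_nat_choice)
    show "\<exists>s. P 0 s"
      by (intro exI[of _ "(0, \<lambda>x. x)"]) (simp add: P_def act.zero_left bounded_linear_ident)
  next
    fix s n assume "P n s"
    then obtain a V where s: "s = (a, V)" and V: "bounded_linear V"
      and inverse: "\<And>x. act a (V x) + t ^ n *\<^sub>R V x = x"
      by (cases s) (auto simp: P_def)
    interpret V: bounded_linear V by fact
    obtain M where M: "M > 0" "\<And>x. norm (V x) \<le> norm x * M"
      using V.pos_bounded by blast
    have "\<forall>\<^sub>F i in F. dist (e i * a) a < (1/2) ^ n"
      by (rule tendstoD[OF e_mult]) simp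
    moreover have "\<forall>\<^sub>F i in F. dist (act (e i) b) b < (1/2) ^ n / (2 * d * M)"
      by (rule tendstoD[OF b]) (use d M in simp)
    ultimately obtain i where i: "norm (e i * a - a) < (1/2) ^ n"
      "norm (act (e i) b - b) < (1/2) ^ n / (2 * d * M)"
      using eventually_happens'[OF \<open>F \<noteq> bot\<close> eventually_conj] by (metis (no_types, lifting) dist_norm)
    have "bounded_linear (\<lambda>x. d *\<^sub>R act (e i) x)"
      by (intro bounded_linear_const_scaleR act.bounded_linear_right)
    then obtain N where N: "bounded_linear N" "\<And>x. N x + d *\<^sub>R act (e i) (N x) = x"
      "\<And>x. N (x + d *\<^sub>R act (e i) x) = x" "\<And>x. norm (N x) \<le> 2 * norm x"
      using neumann_inverse half by blast
    interpret N: bounded_linear N by fact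
    \<comment> \<open>\<open>a'\<close> is the algebra part of \<open>t (1 + d e\<^sub>i) (a + t\<^sup>n)\<close>, where \<open>t d = 1 - t\<close>.\<close>
    define a' where "a' = t *\<^sub>R a + (1 - t) *\<^sub>R (e i * a) + ((1 - t) * t ^ n) *\<^sub>R e i"
    define V' where "V' x = V ((1 / t) *\<^sub>R N x)" for x
    have "bounded_linear V'"
      unfolding V'_def
      by (intro bounded_linear_compose[OF V] bounded_linear_const_scaleR N(1))
    moreover have "act a' (V' x) + t ^ Suc n *\<^sub>R V' x = x" for x
    proof -
      define z where "z = V' x"
      define w where "w = act a z + t ^ n *\<^sub>R z"
      have w: "w = (1 / t) *\<^sub>R N x"
        unfolding w_def z_def V'_def by (rule inverse)
      have "act a' z + t ^ Suc n *\<^sub>R z = t *\<^sub>R w + (1 - t) *\<^sub>R act (e i) w"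
        by (simp add: a'_def w_def act.add_left act.add_right act.scaleR_left act.scaleR_right act_mult
            scaleR_add_right)
      also have "\<dots> = t *\<^sub>R (w + d *\<^sub>R act (e i) w)"
        by (simp add: scaleR_add_right t(3))
      also have "\<dots> = x"
        using t(1) N(2)[of x] by (simp add: w act.scaleR_right scaleR_add_right)
      finally show ?thesis by (simp add: z_def)
    qed
    ultimately have "P (Suc n) (a', V')"
      by (simp add: P_def)
    moreover have "Q n s (a', V')"
    proof -
      have "a' - a = (1 - t) *\<^sub>R (e i * a - a) + ((1 - t) * t ^ n) *\<^sub>R e i"
        by (simp add: a'_def algebra_simps)
      then have "norm (a' - a) \<le> (1 - t) * norm (e i * a - a) + (1 - t) * t ^ n * norm (e i)"
        using t norm_triangle_ineq[of "(1 - t) *\<^sub>R (e i * a - a)" "((1 - t) * t ^ n) *\<^sub>R e i"]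
        by simp
      also have "\<dots> \<le> 1 * norm (e i * a - a) + 1 * t ^ n * C"
        using t C(1) C(2)[of i] by (intro add_mono mult_mono) auto
      finally have "norm (a' - a) \<le> (1/2) ^ n + t ^ n * C"
        using i(1) by simp
      moreover have "norm (V' b - V b) \<le> (1/2) ^ n"
      proof -
        have "(1 / t) *\<^sub>R N b - b = N ((1 / t) *\<^sub>R b - (b + d *\<^sub>R act (e i) b))"
          by (simp only: N.diff N.scaleR N(3))
        also have "(1 / t) *\<^sub>R b - (b + d *\<^sub>R act (e i) b) = d *\<^sub>R (b - act (e i) b)"
          by (simp add: t_def algebra_simps)
        finally have "norm ((1 / t) *\<^sub>R N b - b) \<le> 2 * (d * norm (act (e i) b - b))"
          using N(4)[of "d *\<^sub>R (b - act (e i) b)"] d by (simp add: norm_minus_commute)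
        also have "\<dots> \<le> 2 * (d * ((1/2) ^ n / (2 * d * M)))"
          using i(2) d by (intro mult_left_mono) auto
        also have "\<dots> = (1/2) ^ n / M"
          using d by simp
        finally have "norm ((1 / t) *\<^sub>R N b - b) * M \<le> (1/2) ^ n"
          using M by (simp add: field_simps)
        then show ?thesis
          using M(2)[of "(1 / t) *\<^sub>R N b - b"] by (simp add: V'_def V.diff)
      qed
      ultimately show ?thesis by (simp add: Q_def s)
    qed
    ultimately show "\<exists>s'. P (Suc n) s' \<and> Q n s s'"
      by blast
  qed
  then obtain s where P: "\<And>n. P n (s n)" and Q: "\<And>n. Q n (s n) (s (Suc n))"
    by blast
  define a y where "a = lim (\<lambda>n. fst (s n))" and "y = lim (\<lambda>n. snd (s n) b)"
  have "convergent (\<lambda>n. fst (s n))"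
  proof (rule convergent_if_increments_le)
    show "summable (\<lambda>n. (1/2) ^ n + t ^ n * C)"
      using t by (intro summable_add summable_mult2 summable_geometric) auto
  qed (use Q in \<open>auto simp: Q_def\<close>)
  then have a: "(\<lambda>n. fst (s n)) \<longlonglongrightarrow> a"
    by (simp add: a_def convergent_LIMSEQ_iff)
  have "convergent (\<lambda>n. snd (s n) b)"
  proof (rule convergent_if_increments_le)
    show "summable (\<lambda>n. (1/2 :: real) ^ n)"
      by (intro summable_geometric) auto
  qed (use Q in \<open>auto simp: Q_def\<close>)
  then have y: "(\<lambda>n. snd (s n) b) \<longlonglongrightarrow> y"
    by (simp add: y_def convergent_LIMSEQ_iff)
  have "(\<lambda>n. act (fst (s n)) (snd (s n) b) + t ^ n *\<^sub>R snd (s n) b) \<longlonglongrightarrow> act a y + 0 *\<^sub>R y"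
    using t by (intro tendsto_add act.tendsto a y tendsto_scaleR LIMSEQ_power_zero) auto
  moreover have "act (fst (s n)) (snd (s n) b) + t ^ n *\<^sub>R snd (s n) b = b" for n
    using P[of n] by (simp add: P_def)
  ultimately have "b = act a y"
    by (simp add: LIMSEQ_const_iff)
  then show thesis ..
qed

section \<open>Units of the bidual module\<close>

context left_banach_module_over
begin

lemma dual_action_left:
  assumes f: "f \<in> dual scaleB"
  shows "(\<lambda>a. f (act a b)) \<in> dual scaleA"
proof -
  obtain K where K: "\<And>a. norm (act a b) \<le> norm a * K"
    using action.bounded_linear_left[of b] bounded_linear.bounded by blast
  obtain M where M: "M > 0" "\<And>x. norm (f x) \<le> norm x * M"
    using f bounded_linear.pos_bounded by (auto simp: dual_def)
  have "norm (f (act a b)) \<le> norm a * (K * M)" for a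
  proof -
    have "norm (f (act a b)) \<le> norm (act a b) * M"
      by (rule M)
    also have "\<dots> \<le> norm a * K * M"
      using K M(1) by (intro mult_right_mono) auto
    finally show ?thesis by (simp add: mult.assoc)
  qed
  then show ?thesis
    using f unfolding A.dual_iff B.dual_iff
    by (auto simp: action.add_left act_scale_left)
qed

text \<open>The link between \<open>e''\<close> and the module, on which both directions of the equivalence rest.\<close>

lemma weak_star_limit_on_orbit:
  assumes lim: "weak_star_tendsto scaleA (\<lambda>i. to_bidual scaleA (e i)) e'' F"
    and f: "f \<in> dual scaleB"
  shows "((\<lambda>i. f (act (e i) b)) \<longlongrightarrow> e'' (\<lambda>a. f (act a b))) F"
  using lim dual_action_left[OF f, of b] by (force simp: weak_star_tendsto_def to_bidual_def)

lemma to_bidual_mem: "to_bidual scaleB b \<in> bidual scaleB"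
proof -
  have "norm (f b) \<le> norm b * onorm f" if "f \<in> dual scaleB" for f
    using that onorm[of f b] by (simp add: dual_def mult.commute)
  moreover have "(\<lambda>x. f x + g x) \<in> dual scaleB" if "f \<in> dual scaleB" "g \<in> dual scaleB" for f g
    using that bounded_linear_add[of f g]
    unfolding dual_def Vector_Spaces.linear_iff by (auto simp: algebra_simps)
  moreover have "(\<lambda>x. c * f x) \<in> dual scaleB" if "f \<in> dual scaleB" for f c
    using that bounded_linear_const_mult[of f c]
    unfolding dual_def Vector_Spaces.linear_iff by (auto simp: algebra_simps)
  ultimately show ?thesis
    by (auto simp: bidual_def to_bidual_def)
qed

lemma triple_adj_to_bidual:
  assumes "f \<in> dual scaleB"
  shows "triple_adj scaleB act \<phi> (to_bidual scaleB b) f = \<phi> (\<lambda>a. f (act a b))"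
proof -
  have "(\<lambda>x. f (act a x)) \<in> dual scaleB" for a
    using assms bounded_linear_compose[OF _ action.bounded_linear_right[of a], of f]
    unfolding dual_def Vector_Spaces.linear_iff by (auto simp: action.add_right act_scale_right)
  then show ?thesis
    using assms by (simp add: triple_adj_def adj_def to_bidual_def)
qed

text \<open>
  The transposed extension evaluates \<open>e''\<close> first: its value at \<open>f\<close> is \<open>b''\<close> applied to
  \<open>b \<mapsto> e'' (\<lambda>a. f (act a b))\<close>, a function that norm convergence identifies with \<open>f\<close>. The other
  extension evaluates \<open>b''\<close> first and does not allow this argument.
\<close>

lemma unit_if_approx_identity_converges:
  assumes F: "F \<noteq> bot"
    and weak: "weak_star_tendsto scaleA (\<lambda>i. to_bidual scaleA (e i)) e'' F"
    and lim: "\<And>b. ((\<lambda>i. act (e i) b) \<longlongrightarrow> b) F"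
    and b'': "b'' \<in> bidual scaleB"
  shows "transp_triple_adj_transp scaleB act e'' b'' = b''"
proof
  fix f
  show "transp_triple_adj_transp scaleB act e'' b'' f = b'' f"
  proof (cases "f \<in> dual scaleB")
    case True
    then have "bounded_linear f"
      by (simp add: dual_def)
    then have "((\<lambda>i. f (act (e i) b)) \<longlongrightarrow> f b) F" for b
      using lim by (rule bounded_linear.tendsto)
    then have "e'' (\<lambda>a. f (act a b)) = f b" for b
      using tendsto_unique[OF F] weak_star_limit_on_orbit[OF weak True] by blast
    then show ?thesis
      using True by (simp add: transp_triple_adj_transp_def bil_transp_def triple_adj_def adj_def)
  next
    case False
    then show ?thesis
      using b'' by (simp add: transp_triple_adj_transp_def bil_transp_def triple_adj_def bidual_def extensional_def)
  qed
qed

text \<open>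
  The set \<open>S\<close> of points of norm convergence is a closed subspace containing all products, and \<open>b\<close> is a
  weak limit of the products \<open>act (e i) b\<close>. Closed subspaces are weakly closed by Hahn--Banach.
\<close>

lemma approx_identity_converges_if_weakly:
  assumes e: "bounded_left_approx_identity e F"
    and weak: "\<And>f b. f \<in> dual scaleB \<Longrightarrow> ((\<lambda>i. f (act (e i) b)) \<longlongrightarrow> f b) F"
  shows "((\<lambda>i. act (e i) b) \<longlongrightarrow> b) F"
proof -
  have "F \<noteq> bot" and e_mult: "\<And>a. ((\<lambda>i. e i * a) \<longlongrightarrow> a) F"
    using e by (auto simp: bounded_left_approx_identity_def)
  obtain C where C: "C > 0" "\<And>i. norm (e i) \<le> C"
    using e by (auto simp: bounded_left_approx_identity_def bounded_pos)
  obtain K where K: "K > 0" "\<And>a b. norm (act a b) \<le> norm a * norm b * K"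
    using action.pos_bounded by blast
  define S where "S = {x. ((\<lambda>i. act (e i) x) \<longlongrightarrow> x) F}"
  have orbit: "act a x \<in> S" for a x
    using action.tendsto[OF e_mult tendsto_const, of a x] by (simp add: S_def act_mult)
  have "B.subspace S"
  proof (rule B.subspaceI)
    show "scaleB c x \<in> S" if "x \<in> S" for c x
    proof -
      have norm_eq: "norm (scaleB c u - scaleB c x) = norm c * norm (u - x)" for u
        by (metis B.norm_scale B.scale_right_diff_distrib)
      have "((\<lambda>i. norm c * norm (act (e i) x - x)) \<longlongrightarrow> norm c * 0) F"
        using that unfolding S_def mem_Collect_eq
        by (rule tendsto_mult[OF tendsto_const tendsto_norm_zero[OF LIM_zero]])
      then have "((\<lambda>i. norm (scaleB c (act (e i) x) - scaleB c x)) \<longlongrightarrow> 0) F"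
        by (simp only: norm_eq mult_zero_right)
      then have "((\<lambda>i. scaleB c (act (e i) x) - scaleB c x) \<longlongrightarrow> 0) F"
        by (rule tendsto_norm_zero_cancel)
      then show ?thesis
        unfolding S_def mem_Collect_eq act_scale_right by (rule LIM_zero_cancel)
    qed
  qed (auto simp: S_def action.zero_right action.add_right intro: tendsto_add)
  moreover have "closed S"
    unfolding closure_subset_eq[symmetric]
  proof
    fix x assume x: "x \<in> closure S"
    \<comment> \<open>For \<open>z\<close> in \<open>S\<close> within \<open>\<delta>\<close> of \<open>x\<close>, the error at \<open>x\<close> is eventually at most
      \<open>C * K * \<delta> + \<delta> + \<delta> = L * \<delta>\<close>.\<close>
    define L where "L = C * K + 2"
    have L: "L > 0"
      using C K by (simp add: L_def add_pos_pos)
    have "\<forall>\<^sub>F i in F. dist (act (e i) x) x < \<epsilon>" if "\<epsilon> > 0" for \<epsilon>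
    proof -
      define \<delta> where "\<delta> = \<epsilon> / L"
      have "C * K * \<delta> + 2 * \<delta> = L * \<delta>"
        by (simp add: L_def distrib_right)
      then have \<delta>: "\<delta> > 0" "C * K * \<delta> + 2 * \<delta> = \<epsilon>"
        using that L by (simp_all add: \<delta>_def)
      obtain z where z: "z \<in> S" "norm (x - z) < \<delta>"
        using x \<delta>(1) by (metis closure_approachable dist_commute dist_norm)
      then have "\<forall>\<^sub>F i in F. dist (act (e i) z) z < \<delta>"
        using \<delta>(1) by (intro tendstoD) (simp_all add: S_def)
      then show ?thesis
      proof eventually_elim
        case (elim i)
        have "norm (act (e i) (x - z)) \<le> norm (e i) * norm (x - z) * K"
          by (rule K)
        also have "\<dots> \<le> C * \<delta> * K"
          using C K z(2) by (intro mult_right_mono mult_mono) auto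
        finally have *: "norm (act (e i) (x - z)) \<le> C * K * \<delta>"
          by (simp add: mult.commute mult.left_commute)
        have "act (e i) x - x = act (e i) (x - z) + (act (e i) z - z) - (x - z)"
          by (simp add: action.diff_right)
        then have "norm (act (e i) x - x) \<le> norm (act (e i) (x - z)) + norm (act (e i) z - z) + norm (x - z)"
          using norm_triangle_ineq[of "act (e i) (x - z)" "act (e i) z - z"]
            norm_triangle_ineq4[of "act (e i) (x - z) + (act (e i) z - z)" "x - z"] by simp
        then show ?case
          using * z(2) elim \<delta>(2) by (simp add: dist_norm)
      qed
    qed
    then show "x \<in> S"
      by (simp add: S_def tendsto_iff)
  qed
  moreover have "f b = 0" if f: "f \<in> dual scaleB" "\<And>x. x \<in> S \<Longrightarrow> f x = 0" for f
    using weak[OF f(1), of b] orbit f(2) tendsto_unique[OF \<open>F \<noteq> bot\<close> _ tendsto_const] by fastforce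
  ultimately have "b \<in> S"
    using B.dual_separates_closed_subspace by metis
  then show ?thesis
    by (simp add: S_def)
qed

end

theorem mainTheorem7:
  fixes scaleA :: "'k::{real_normed_field,euclidean_space} \<Rightarrow> 'a::{real_normed_algebra,banach} \<Rightarrow> 'a"
    and scaleB :: "'k \<Rightarrow> 'b::banach \<Rightarrow> 'b"
    and act :: "'a \<Rightarrow> 'b \<Rightarrow> 'b"
    and e :: "'i \<Rightarrow> 'a" and F :: "'i filter"
    and e'' :: "('a \<Rightarrow> 'k) \<Rightarrow> 'k"
  assumes "left_banach_module_over scaleA scaleB act"
    and "bounded_left_approx_identity e F"
    and "e'' \<in> bidual scaleA"
    and "weak_star_tendsto scaleA (\<lambda>i. to_bidual scaleA (e i)) e'' F"
    and "\<forall>a''\<in>bidual scaleA. first_arens scaleA e'' a'' = a''"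
    and "Zt scaleB act e'' = bidual scaleB"
  shows "factors_on_right act \<longleftrightarrow> (\<forall>b''\<in>bidual scaleB. triple_adj scaleB act e'' b'' = b'')"
proof -
  interpret left_banach_module_over scaleA scaleB act by fact
  have "F \<noteq> bot" and e_mult: "\<And>a. ((\<lambda>i. e i * a) \<longlongrightarrow> a) F"
    using assms(2) by (auto simp: bounded_left_approx_identity_def)
  show ?thesis
  proof
    assume factors: "factors_on_right act"
    have "((\<lambda>i. act (e i) b) \<longlongrightarrow> b) F" for b
    proof -
      obtain a y where "b = act a y"
        using factors unfolding factors_on_right_def by blast
      then show ?thesis
        using action.tendsto[OF e_mult tendsto_const, of a y] by (simp add: act_mult)
    qed
    then have "transp_triple_adj_transp scaleB act e'' b'' = b''" if "b'' \<in> bidual scaleB" for b''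
      using unit_if_approx_identity_converges \<open>F \<noteq> bot\<close> assms(4) that by blast
    moreover have "transp_triple_adj_transp scaleB act e'' b'' = triple_adj scaleB act e'' b''"
      if "b'' \<in> bidual scaleB" for b''
      using that unfolding assms(6)[symmetric] by (simp add: Zt_def)
    ultimately show "\<forall>b''\<in>bidual scaleB. triple_adj scaleB act e'' b'' = b''"
      by simp
  next
    assume unit: "\<forall>b''\<in>bidual scaleB. triple_adj scaleB act e'' b'' = b''"
    have "((\<lambda>i. f (act (e i) b)) \<longlongrightarrow> f b) F" if f: "f \<in> dual scaleB" for f b
    proof -
      have "e'' (\<lambda>a. f (act a b)) = to_bidual scaleB b f"
        using unit to_bidual_mem triple_adj_to_bidual[OF f] by metis
      then show ?thesis
        using weak_star_limit_on_orbit[OF assms(4) f, of b] f by (simp add: to_bidual_def)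
    qed
    then have "((\<lambda>i. act (e i) b) \<longlongrightarrow> b) F" for b
      using approx_identity_converges_if_weakly[OF assms(2)] by blast
    then have "\<exists>a y. b = act a y" for b
      using cohen_factorization[OF action.bounded_bilinear_axioms act_mult assms(2)] by metis
    then show "factors_on_right act"
      unfolding factors_on_right_def by blast
  qed
qed

end
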